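(* For every integer $n\ge1$, \[ (-1)^n\frac{D_n}{n!}=\sum_{m=1}^{n}\binom{n-1}{m-1}\frac{\widehat{D}_m}{m!}, \qquad (-1)^n\frac{\widehat{D}_n}{n!}=\sum_{m=1}^{n}\binom{n-1}{m-1}\frac{D_m}{m!}. \]
   Context: The Daehee numbers $D_n$ are defined by $\frac{\log(1+t)}{t}=\sum_{n\ge0}D_n\frac{t^n}{n!}$. The Daehee numbers of the second kind $\widehat{D}_n$ are defined by $\frac{(1+t)\log(1+t)}{t}=\sum_{n\ge0}\widehat{D}_n\frac{t^n}{n!}$ (equivalently, $\widehat{D}_n=\int_{\mathbb{Z}_p}(-x)_n\,d\mu_0(x)$ where $\int_{\mathbb{Z}_p}f\,d\mu_0=\lim_{N\to\infty}p^{-N}\sum_{x=0}^{p^N-1}f(x)$ is the Volkenborn integral and $(z)_n=z(z-1)\cdots(z-n+1)$). *)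

theory Defs
  imports "HOL-Computational_Algebra.Formal_Power_Series"
begin

text \<open>
  The library series \<open>fps_ln c\<close> is \<open>(1/c) * log (1 + t)\<close>, so \<open>fps_ln 1\<close> is \<open>log (1 + t)\<close>.
  Division by \<open>fps_X\<close> is exact, because \<open>fps_ln 1\<close> has zero constant term.
\<close>

definition daehee_gf :: "rat fps" where
  "daehee_gf = fps_ln 1 / fps_X"

definition daehee2_gf :: "rat fps" where
  "daehee2_gf = ((1 + fps_X) * fps_ln 1) / fps_X"

definition daehee :: "nat \<Rightarrow> rat" where
  "daehee n = fact n * fps_nth daehee_gf n"

definition daehee2 :: "nat \<Rightarrow> rat" where
  "daehee2 n = fact n * fps_nth daehee2_gf n"

lemma daehee_gf_times_X: "daehee_gf * fps_X = fps_ln 1"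
proof (rule fps_ext)
  fix n show "fps_nth (daehee_gf * fps_X) n = fps_nth (fps_ln 1) n"
    by (cases n) (simp_all add: daehee_gf_def fps_ln_def)
qed

lemma daehee2_gf_times_X: "daehee2_gf * fps_X = (1 + fps_X) * fps_ln 1"
proof (rule fps_ext)
  fix n show "fps_nth (daehee2_gf * fps_X) n = fps_nth ((1 + fps_X) * fps_ln 1) n"
    by (cases n) (simp_all add: daehee2_gf_def fps_ln_def)
qed

lemma daehee_egf: "fps_ln 1 / fps_X = Abs_fps (\<lambda>n. daehee n / fact n)"
  by (rule fps_ext) (simp add: daehee_def daehee_gf_def)

lemma daehee2_egf:
  "((1 + fps_X) * fps_ln 1) / fps_X = Abs_fps (\<lambda>n. daehee2 n / fact n)"
  by (rule fps_ext) (simp add: daehee2_def daehee2_gf_def)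

end

theory Submission imports Defs begin

text \<open>
  With \<open>D\<^sub>n / n! = (-1)\<^sup>n / (n + 1)\<close> and, for \<open>n \<ge> 1\<close>, the second-kind coefficient equal to
  \<open>(-1)\<^sup>n (1 / (n + 1) - 1 / n)\<close>, both identities reduce to the partial fraction expansion of
  \<open>k! / (x (x + 1) \<dots> (x + k))\<close> evaluated at \<open>x = 1\<close> and \<open>x = 2\<close>, where \<open>k = n - 1\<close>.
\<close>

text \<open>Writing \<open>S k x\<close> for the sum, Pascal's rule gives
  \<open>S (k + 1) x = S k x - S k (x + 1)\<close>, so the induction needs \<open>x\<close>
  arbitrary. The hypothesis keeps all denominators nonzero.\<close>

lemma alternating_binomial_sum_inverse:
  fixes x :: "'a::field_char_0"
  assumes "pochhammer x (Suc k) \<noteq> 0"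
  shows "(\<Sum>j\<le>k. (-1) ^ j * of_nat (k choose j) / (x + of_nat j)) = fact k / pochhammer x (Suc k)"
  using assms
proof (induction k arbitrary: x)
  case 0
  then show ?case by simp
next
  case (Suc k)
  let ?S = "\<lambda>k x. \<Sum>j\<le>k. (-1) ^ j * of_nat (k choose j) / (x + of_nat j :: 'a)"
  define p where "p = pochhammer (x + 1) k"
  have left: "pochhammer x (Suc k) = x * p"
    by (simp add: p_def pochhammer_rec)
  have right: "pochhammer (x + 1) (Suc k) = p * (x + 1 + of_nat k)"
    by (simp add: p_def pochhammer_Suc)
  have both: "pochhammer x (Suc (Suc k)) = x * p * (x + 1 + of_nat k)"
    using right by (simp add: pochhammer_rec[of x "Suc k"])
  have nz: "x \<noteq> 0" "p \<noteq> 0" "x + 1 + of_nat k \<noteq> 0"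
    using Suc.prems both by auto
  have "?S (Suc k) x = 1 / x + (\<Sum>j\<le>k. (-1) ^ Suc j * of_nat (Suc k choose Suc j) / (x + of_nat (Suc j)))"
    by (simp add: sum.atMost_Suc_shift del: sum.atMost_Suc)
  also have "\<dots> = (1 / x + (\<Sum>j\<le>k. (-1) ^ Suc j * of_nat (k choose Suc j) / (x + of_nat (Suc j))))
      - ?S k (x + 1)"
    by (simp add: sum_subtractf[symmetric] sum_negf[symmetric] add_divide_distrib diff_divide_distrib algebra_simps
             flip: sum.distrib)
  \<comment> \<open>\<open>1 / x\<close> is the term at \<open>j = 0\<close>; the added top term
    vanishes because \<open>k choose Suc k = 0\<close>.\<close>
  also have "1 / x + (\<Sum>j\<le>k. (-1) ^ Suc j * of_nat (k choose Suc j) / (x + of_nat (Suc j)))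
      = (\<Sum>j\<le>Suc k. (-1) ^ j * of_nat (k choose j) / (x + of_nat j))"
    by (simp add: sum.atMost_Suc_shift del: sum.atMost_Suc)
  also have "\<dots> = ?S k x"
    by simp
  also have "?S k x - ?S k (x + 1) = fact k / (x * p) - fact k / (p * (x + 1 + of_nat k))"
    using nz Suc.IH[of x] Suc.IH[of "x + 1"] unfolding left right by simp
  \<comment> \<open>Over the common denominator, \<open>(x + 1 + k) - x = k + 1\<close> raises
    \<open>fact k\<close> to \<open>fact (Suc k)\<close>.\<close>
  also have "\<dots> = fact (Suc k) / pochhammer x (Suc (Suc k))"
    using nz by (simp add: both divide_simps) (simp add: algebra_simps)
  finally show ?case .
qed

lemma daehee_div_fact: "daehee n / fact n = (-1) ^ n / of_nat (Suc n)"
  by (simp add: daehee_def daehee_gf_def fps_ln_def)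

text \<open>The series splits as log(1 + t)/t + log(1 + t), one fraction from each summand. The
  index \<open>Suc n\<close> avoids the constant term, where log(1 + t) contributes nothing.\<close>

lemma daehee2_div_fact:
  "daehee2 (Suc n) / fact (Suc n) = (-1) ^ n * (1 / of_nat (Suc n) - 1 / of_nat (Suc (Suc n)))"
proof -
  have "daehee2 (Suc n) / fact (Suc n) = fps_nth daehee2_gf (Suc n)"
    by (simp add: daehee2_def del: fact_Suc)
  also have "\<dots> = (-1) ^ n * (1 / of_nat (Suc n) - 1 / of_nat (Suc (Suc n)))"
    by (simp add: daehee2_gf_def fps_ln_def distrib_right right_diff_distrib)
  finally show ?thesis .
qed

theorem theorem8:
  fixes n :: nat
  assumes "n \<ge> 1"
  shows "(-1) ^ n * (daehee n / fact n) =
           (\<Sum>m = 1..n. of_nat ((n - 1) choose (m - 1)) * (daehee2 m / fact m)) \<and>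
         (-1) ^ n * (daehee2 n / fact n) =
           (\<Sum>m = 1..n. of_nat ((n - 1) choose (m - 1)) * (daehee m / fact m))"
proof -
  obtain k where n: "n = Suc k"
    using assms by (cases n) auto
  have shift: "(\<Sum>m = 1..n. f m) = (\<Sum>j\<le>k. f (Suc j))" for f :: "nat \<Rightarrow> rat"
    by (simp add: n sum.atLeast_Suc_atMost_Suc_shift atMost_atLeast0 del: sum.cl_ivl_Suc)
  let ?S = "\<lambda>x. \<Sum>j\<le>k. (-1) ^ j * of_nat (k choose j) / (x + of_nat j :: rat)"
  have S1: "?S 1 = 1 / of_nat (Suc k)"
    using alternating_binomial_sum_inverse[of "1 :: rat" k]
    by (simp add: pochhammer_fact[symmetric])
  \<comment> \<open>Prepending the factor 1 turns this product into a factorial.\<close>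
  have "pochhammer 2 (Suc k) = (fact (Suc (Suc k)) :: rat)"
    using pochhammer_rec[of "1 :: rat" "Suc k"] pochhammer_fact[of "Suc (Suc k)", where ?'a = rat] by simp
  then have S2: "?S 2 = 1 / (of_nat (Suc k) * of_nat (Suc (Suc k)))"
    using alternating_binomial_sum_inverse[of "2 :: rat" k] by simp
  have pf: "1 / (of_nat (Suc k) * of_nat (Suc (Suc k)))
      = 1 / of_nat (Suc k) - (1 / of_nat (Suc (Suc k)) :: rat)"
    by (simp add: divide_simps)
  have sum2: "(\<Sum>m = 1..n. of_nat ((n - 1) choose (m - 1)) * (daehee2 m / fact m)) = ?S 1 - ?S 2"
    unfolding shift daehee2_div_fact
    by (simp add: n algebra_simps flip: sum_subtractf)
  have sum1: "(\<Sum>m = 1..n. of_nat ((n - 1) choose (m - 1)) * (daehee m / fact m)) = - ?S 2"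
    unfolding shift daehee_div_fact
    by (simp add: n algebra_simps flip: sum_negf)
  show ?thesis
    \<comment> \<open>By \<open>pf\<close>, \<open>?S 1 - ?S 2\<close> collapses to
      \<open>1 / (k + 2)\<close>; only powers of -1 remain to be cancelled.\<close>
    unfolding sum1 sum2 S1 S2 pf unfolding n daehee_div_fact daehee2_div_fact
    by (simp flip: power_mult_distrib mult.assoc)
qed

end
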